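(* Assume the standing assumptions (i)--(iii), the bounded-iterates assumption with constant $D$, and $M\ge L_2$ (all in the context), and consider iterates generated by DisGrem. Then for all $k\ge0$, $$D(\tilde{\mathcal H}_{k+1})\le\rho^{\tau_{k+1}}\rho^{t_k}\Bigl(D(\tilde{\mathcal H}_k)+\frac{\sqrt d\,L_2}{\sqrt N}\|X_{k+1}-X_k\|\Bigr),$$ and in particular $$D(\tilde{\mathcal H}_{k+1})\le\rho^{\tau_{k+1}}\rho^{t_k}\bigl(D(\tilde{\mathcal H}_k)+2\sqrt d\,L_2D\bigr).$$
   Context: Norms: $\|\cdot\|$ is the Euclidean norm for (stacked) vectors; $\|\cdot\|_2$, $\|\cdot\|_F$ are the spectral and Frobenius norms for matrices. Problem and standing assumptions. $f=\frac1N\sum_{i=1}^N f_i$ with $f_i:\mathbb R^d\to\mathbb R$. (i) Each $f_i$ is convex, twice continuously differentiable, with $\|\nabla f_i(x)-\nabla f_i(y)\|\le L_1\|x-y\|$ and $\|\nabla^2 f_i(x)-\nabla^2 f_i(y)\|_2\le L_2\|x-y\|$ for all $x,y$. (ii) $W\in\mathbb R^{N\times N}$ is entrywise nonnegative, symmetric, doubly stochastic, with positive diagonal, and $\rho:=\|W-\frac1N\mathbf 1\mathbf 1^\top\|_2<1$. (iii) $f$ is coercive. Algorithm DisGrem. Inputs: $x_{i,0}\in\mathbb R^d$ ($i=1,\dots,N$), $M>0$, integers $\tau_k,t_k\ge1$. Initialize $g_{i,0}=\nabla f_i(x_{i,0})$, $H_{i,0}=\nabla^2 f_i(x_{i,0})$.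 For $k\ge 0$: (A) $\tilde x_{i,k}=\sum_j[W^{\tau_k}]_{ij}x_{j,k}$, $\tilde g_{i,k}=\sum_j[W^{\tau_k}]_{ij}g_{j,k}$, $\tilde H_{i,k}=\sum_j[W^{\tau_k}]_{ij}H_{j,k}$. (B) $\lambda_{i,k}=\sqrt{M\|\tilde g_{i,k}\|}$, $\delta_{i,k}=\max\{0,-\lambda_{\min}(\tilde H_{i,k})\}$; if $\tilde g_{i,k}=0$ then $s_{i,k}=0$, otherwise $s_{i,k}$ solves $(\tilde H_{i,k}+(\lambda_{i,k}+\delta_{i,k})I)s_{i,k}=-\tilde g_{i,k}$. (C) $x_{i,k+1}=\sum_j[W^{t_k}]_{ij}(\tilde x_{j,k}+s_{j,k})$. (D) $g_{i,k+1}=\sum_j[W^{t_k}]_{ij}(\tilde g_{j,k}+\nabla f_j(x_{j,k+1})-\nabla f_j(x_{j,k}))$ and $H_{i,k+1}=\sum_j[W^{t_k}]_{ij}(\tilde H_{j,k}+\nabla^2 f_j(x_{j,k+1})-\nabla^2 f_j(x_{j,k}))$. Bounded-iterates assumption. There are $x_\star\in\arg\min f$ and a finite $D>0$ such that $\|\bar x_k-x_\star\|\le D$, $\|x_{i,k}-x_\star\|\le D$, $\|\tilde x_{i,k}-x_\star\|\le D$ for all $k\ge0$ and all $i$, where $\bar x_k=\frac1N\sum_ix_{i,k}$. Notation. $X_k=[x_{1,k};\dots;x_{N,k}]\in\mathbb R^{Nd}$. $\tilde{\mathcal H}_k$ is the stack of the vectorized matrices $\tilde H_{1,k},\dots,\tilde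 H_{N,k}$, in $\mathbb R^{Nd^2}$, and $D(\tilde{\mathcal H}_k)=\bigl(\frac1N\sum_i\|\tilde H_{i,k}-\frac1N\sum_j\tilde H_{j,k}\|_F^2\bigr)^{1/2}$ (the dispersion $D(\cdot)$ is not to be confused with the constant $D$). *)

theory Defs
  imports "HOL-Analysis.Analysis"
begin

text \<open>
  The ambient space is \<open>real^'d\<close> and the agents are indexed by the finite type \<open>'n\<close>, so that
  \<open>N = CARD('n)\<close> and \<open>d = CARD('d)\<close>.  A family \<open>(y\<^sub>i)\<close> of vectors or matrices, one per agent, is a
  vector \<open>Y :: 'a^'n\<close> with entries \<open>Y $ i\<close>.  The library norm is the Euclidean norm of all the
  scalar entries: it is the norm of the stacked vector on \<open>real^'d^'n\<close> and the Frobenius norm on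
  \<open>real^'d^'d\<close>.
\<close>

lemma norm_eq_frobenius:
  fixes A :: "real^'m^'n"
  shows "norm A = sqrt (\<Sum>i\<in>UNIV. \<Sum>j\<in>UNIV. (A $ i $ j)\<^sup>2)"
  by (simp add: norm_vec_def L2_set_def sum_nonneg)

definition spectral_norm :: "real^'m^'n \<Rightarrow> real" where
  "spectral_norm A = onorm ((*v) A)"

text \<open>The instance \<open>(*)\<close> on vectors is componentwise, hence no use of the library power.\<close>

primrec mat_pow :: "real^'n^'n \<Rightarrow> nat \<Rightarrow> real^'n^'n" where
  "mat_pow A 0 = mat 1"
| "mat_pow A (Suc k) = A ** mat_pow A k"

definition lambda_min :: "real^'d^'d \<Rightarrow> real" where
  "lambda_min A = Min {c. \<exists>v. v \<noteq> 0 \<and> A *v v = c *\<^sub>R v}"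

definition gradient :: "(real^'d \<Rightarrow> real) \<Rightarrow> real^'d \<Rightarrow> real^'d" where
  "gradient f x = (\<chi> i. frechet_derivative f (at x) (axis i 1))"

definition hessian :: "(real^'d \<Rightarrow> real) \<Rightarrow> real^'d \<Rightarrow> real^'d^'d" where
  "hessian f x = matrix (frechet_derivative (gradient f) (at x))"

definition twice_cont_diff :: "(real^'d \<Rightarrow> real) \<Rightarrow> bool" where
  "twice_cont_diff f \<longleftrightarrow>
     (\<forall>x. f differentiable (at x)) \<and> (\<forall>x. gradient f differentiable (at x)) \<and>
     continuous_on UNIV (hessian f)"

lemma GDERIV_gradient:
  assumes "f differentiable (at x)"
  shows "GDERIV f x :> gradient f x"
proof -
  have f': "(f has_derivative frechet_derivative f (at x)) (at x)"
    using assms frechet_derivative_works by blast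
  then interpret bounded_linear "frechet_derivative f (at x)"
    by (rule has_derivative_bounded_linear)
  have "frechet_derivative f (at x) h = inner h (gradient f x)" for h
  proof -
    have "frechet_derivative f (at x) h
        = frechet_derivative f (at x) (\<Sum>i\<in>UNIV. (h $ i) *\<^sub>R axis i 1)"
      using basis_expansion[of h] by (simp add: scalar_mult_eq_scaleR)
    also have "\<dots> = inner h (gradient f x)"
      by (simp add: sum scaleR gradient_def inner_vec_def)
    finally show ?thesis .
  qed
  then have "frechet_derivative f (at x) = (\<lambda>h. inner h (gradient f x))" by (rule ext)
  then show ?thesis using f' by (simp add: gderiv_def)
qed

lemma has_derivative_hessian:
  assumes "gradient f differentiable (at x)"
  shows "(gradient f has_derivative (*v) (hessian f x)) (at x)"
proof -
  have f': "(gradient f has_derivative frechet_derivative (gradient f) (at x)) (at x)"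
    using assms frechet_derivative_works by blast
  then have "linear (frechet_derivative (gradient f) (at x))"
    by (rule has_derivative_linear)
  then have "(*v) (hessian f x) = frechet_derivative (gradient f) (at x)"
    unfolding hessian_def by (intro ext matrix_works) (simp add: linear_matrix_vector_mul_eq)
  then show ?thesis using f' by simp
qed

definition coercive :: "('a::real_normed_vector \<Rightarrow> real) \<Rightarrow> bool" where
  "coercive f \<longleftrightarrow> filterlim f at_top at_infinity"

definition average :: "'a::real_vector^'n \<Rightarrow> 'a" where
  "average Y = (1 / real CARD('n)) *\<^sub>R (\<Sum>i\<in>UNIV. Y $ i)"

definition dispersion :: "'a::real_normed_vector^'n \<Rightarrow> real" where
  "dispersion Y = sqrt (1 / real CARD('n) * (\<Sum>i\<in>UNIV. (norm (Y $ i - average Y))\<^sup>2))"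

definition mix :: "real^'n^'n \<Rightarrow> 'a::real_vector^'n \<Rightarrow> 'a^'n" where
  "mix A Y = (\<chi> i. \<Sum>j\<in>UNIV. (A $ i $ j) *\<^sub>R Y $ j)"

definition objective :: "('n::finite \<Rightarrow> real^'d \<Rightarrow> real) \<Rightarrow> real^'d \<Rightarrow> real" where
  "objective f x = 1 / real CARD('n) * (\<Sum>i\<in>UNIV. f i x)"

definition gradients :: "('n \<Rightarrow> real^'d \<Rightarrow> real) \<Rightarrow> real^'d^'n \<Rightarrow> real^'d^'n" where
  "gradients f X = (\<chi> i. gradient (f i) (X $ i))"

definition hessians :: "('n \<Rightarrow> real^'d \<Rightarrow> real) \<Rightarrow> real^'d^'n \<Rightarrow> real^'d^'d^'n" where
  "hessians f X = (\<chi> i. hessian (f i) (X $ i))"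

definition contraction :: "real^'n^'n \<Rightarrow> real" where
  "contraction W = spectral_norm (W - (\<chi> i j. 1 / real CARD('n)))"

definition mixing_matrix :: "real^'n^'n \<Rightarrow> bool" where
  "mixing_matrix W \<longleftrightarrow>
     (\<forall>i j. 0 \<le> W $ i $ j) \<and> transpose W = W \<and>
     (\<forall>i. (\<Sum>j\<in>UNIV. W $ i $ j) = 1) \<and> (\<forall>j. (\<Sum>i\<in>UNIV. W $ i $ j) = 1) \<and>
     (\<forall>i. 0 < W $ i $ i) \<and> contraction W < 1"

definition newton_step :: "real \<Rightarrow> real^'d^'d \<Rightarrow> real^'d \<Rightarrow> real^'d \<Rightarrow> bool" where
  "newton_step M H g s \<longleftrightarrow>
     (let l = sqrt (M * norm g); \<delta> = max 0 (- lambda_min H)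
      in if g = 0 then s = 0 else (H + mat (l + \<delta>)) *v s = - g)"

text \<open>The initial point \<open>x 0\<close> is unconstrained.  \<open>xt\<close>, \<open>gt\<close>, \<open>Ht\<close> are the tilde quantities.\<close>

definition disgrem ::
  "real^'n^'n \<Rightarrow> ('n \<Rightarrow> real^'d \<Rightarrow> real) \<Rightarrow> real \<Rightarrow> (nat \<Rightarrow> nat) \<Rightarrow> (nat \<Rightarrow> nat)
   \<Rightarrow> (nat \<Rightarrow> real^'d^'n) \<Rightarrow> (nat \<Rightarrow> real^'d^'n) \<Rightarrow> (nat \<Rightarrow> real^'d^'d^'n)
   \<Rightarrow> (nat \<Rightarrow> real^'d^'n) \<Rightarrow> (nat \<Rightarrow> real^'d^'n) \<Rightarrow> (nat \<Rightarrow> real^'d^'d^'n)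
   \<Rightarrow> (nat \<Rightarrow> real^'d^'n) \<Rightarrow> bool" where
  "disgrem W f M \<tau> t x g H xt gt Ht s \<longleftrightarrow>
     g 0 = gradients f (x 0) \<and> H 0 = hessians f (x 0) \<and>
     (\<forall>k. xt k = mix (mat_pow W (\<tau> k)) (x k) \<and>
          gt k = mix (mat_pow W (\<tau> k)) (g k) \<and>
          Ht k = mix (mat_pow W (\<tau> k)) (H k) \<and>
          (\<forall>i. newton_step M (Ht k $ i) (gt k $ i) (s k $ i)) \<and>
          x (Suc k) = mix (mat_pow W (t k)) (xt k + s k) \<and>
          g (Suc k) = mix (mat_pow W (t k)) (gt k + gradients f (x (Suc k)) - gradients f (x k)) \<and>
          H (Suc k) = mix (mat_pow W (t k)) (Ht k + hessians f (x (Suc k)) - hessians f (x k)))"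

end

theory Submission
  imports Defs
begin

text \<open>
  Dispersion is the distance, up to the factor \<open>1 / sqrt N\<close>, from a family to its constant average
  family.  It is therefore a seminorm dominated by the norm (\<open>dispersion_triangle\<close>,
  \<open>dispersion_le_norm\<close>).  A doubly stochastic \<open>W\<close> preserves the average and fixes constant
  families, so on deviations from the average it acts as \<open>W - J\<close> with \<open>J = (1/N) 1 1\<^sup>T\<close>.  Acting
  on a family of vectors means acting on each scalar coordinate separately, hence
  the operator norm of \<open>W - J\<close> also bounds its action on matrix families in the Frobenius norm.  Each
  mixing round thus contracts the dispersion by the factor \<open>contraction W\<close>
  (\<open>dispersion_mix_mat_pow\<close>).

  One iteration passes from \<open>Ht k\<close> to \<open>Ht (k + 1)\<close> by adding the Hessian increment, mixing \<open>t k\<close> times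
  and then mixing \<open>\<tau> (k + 1)\<close> times.  The increment has dispersion at most its norm divided by
  \<open>sqrt N\<close>, and the Lipschitz bound on Hessians, given in the spectral norm, carries over to the
  Frobenius norm at the cost of a factor \<open>sqrt d\<close> (\<open>norm_le_spectral_norm\<close>).  For the second
  bound, consecutive iterates of one agent both lie in the ball of radius \<open>D\<close> about the minimizer,
  so they are at distance at most \<open>2 D\<close>, and the stacked difference is at most \<open>sqrt N\<close> times that.
\<close>

section \<open>Spectral and Frobenius norms\<close>

lemma norm_matrix_vector_mult_le:
  fixes A :: "real^'m^'n"
  shows "norm (A *v v) \<le> spectral_norm A * norm v"
  unfolding spectral_norm_def by (rule onorm) simp

lemma spectral_norm_nonneg: "0 \<le> spectral_norm (A :: real^'m^'n)"
  unfolding spectral_norm_def by (rule onorm_pos_le) simp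

lemma norm_vec_sq: "(norm (Y :: 'a::real_normed_vector^'n))\<^sup>2 = (\<Sum>i\<in>UNIV. (norm (Y $ i))\<^sup>2)"
  by (simp add: norm_vec_def L2_set_def sum_nonneg)

text \<open>The squared Frobenius norm adds up the squared norms of the columns, and column \<open>j\<close> is the
  image of the \<open>j\<close>-th unit vector.\<close>

lemma norm_le_spectral_norm:
  fixes A :: "real^'m^'n"
  shows "norm A \<le> sqrt (real CARD('m)) * spectral_norm A"
proof (rule power2_le_imp_le)
  have "(norm A)\<^sup>2 = (\<Sum>i\<in>UNIV. \<Sum>j\<in>UNIV. (A $ i $ j)\<^sup>2)"
    by (simp add: norm_vec_sq)
  also have "\<dots> = (\<Sum>j\<in>UNIV. \<Sum>i\<in>UNIV. (A $ i $ j)\<^sup>2)"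
    by (rule sum.swap)
  also have "\<dots> = (\<Sum>j\<in>UNIV. (norm (A *v axis j 1))\<^sup>2)"
    by (simp add: norm_vec_sq matrix_vector_mult_basis column_def)
  also have "\<dots> \<le> (\<Sum>j\<in>(UNIV::'m set). (spectral_norm A)\<^sup>2)"
  proof (intro sum_mono power_mono)
    show "norm (A *v axis j 1) \<le> spectral_norm A" for j
      using norm_matrix_vector_mult_le[of A "axis j 1"] by simp
  qed simp
  finally show "(norm A)\<^sup>2 \<le> (sqrt (real CARD('m)) * spectral_norm A)\<^sup>2"
    by (simp add: power_mult_distrib)
qed (simp add: spectral_norm_nonneg)

lemma norm_vec_le_uniform:
  fixes Y :: "'a::real_normed_vector^'n"
  assumes "\<And>i. norm (Y $ i) \<le> c"
  shows "norm Y \<le> sqrt (real CARD('n)) * c"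
proof (rule power2_le_imp_le)
  have "0 \<le> c" using assms norm_ge_zero order_trans by blast
  then show "0 \<le> sqrt (real CARD('n)) * c" by simp
  have "(norm Y)\<^sup>2 \<le> (\<Sum>i\<in>(UNIV::'n set). c\<^sup>2)"
    unfolding norm_vec_sq by (intro sum_mono power_mono assms) simp
  then show "(norm Y)\<^sup>2 \<le> (sqrt (real CARD('n)) * c)\<^sup>2"
    by (simp add: power_mult_distrib)
qed

section \<open>Mixing families of vectors\<close>

lemma mix_mult: "mix (A ** B) Y = mix A (mix B Y)"
proof -
  have "(\<Sum>j\<in>UNIV. \<Sum>k\<in>UNIV. (A $ i $ k * B $ k $ j) *\<^sub>R Y $ j)
      = (\<Sum>k\<in>UNIV. \<Sum>j\<in>UNIV. (A $ i $ k * B $ k $ j) *\<^sub>R Y $ j)" for i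
    by (rule sum.swap)
  then show ?thesis
    by (simp add: mix_def matrix_matrix_mult_def vec_eq_iff scaleR_sum_left scaleR_sum_right)
qed

lemma mix_mat_1: "mix (mat 1) Y = Y"
proof -
  have "(\<Sum>j\<in>UNIV. (if i = j then 1 else 0 :: real) *\<^sub>R Y $ j) = Y $ i" for i
    by (simp add: if_distrib[of "\<lambda>c. c *\<^sub>R _"] cong: if_cong)
  then show ?thesis by (simp add: mix_def mat_def vec_eq_iff)
qed

text \<open>Mixing acts on the scalar coordinates with respect to an orthonormal basis independently, by
  the matrix itself, and the squared norm is the sum of the squared norms of these coordinates.\<close>

lemma norm_mix_le:
  fixes Y :: "'a::euclidean_space^'n"
  shows "norm (mix A Y) \<le> spectral_norm A * norm Y"
proof (rule power2_le_imp_le)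
  define coord where "coord b Z = (\<chi> j. Z $ j \<bullet> b)" for b and Z :: "'a^'n"
  have norm_coord: "(norm Z)\<^sup>2 = (\<Sum>b\<in>Basis. (norm (coord b Z))\<^sup>2)" for Z
  proof -
    have "(norm Z)\<^sup>2 = (\<Sum>i\<in>UNIV. \<Sum>b\<in>Basis. (Z $ i \<bullet> b)\<^sup>2)"
      unfolding norm_vec_sq power2_norm_eq_inner
      by (subst euclidean_inner) (simp add: power2_eq_square)
    also have "\<dots> = (\<Sum>b\<in>Basis. \<Sum>i\<in>UNIV. (Z $ i \<bullet> b)\<^sup>2)"
      by (rule sum.swap)
    finally show ?thesis by (simp add: norm_vec_sq coord_def)
  qed
  have coord_mix: "coord b (mix A Y) = A *v coord b Y" for b
    by (simp add: coord_def mix_def matrix_vector_mult_def vec_eq_iff inner_sum_left)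
  have "(norm (mix A Y))\<^sup>2 \<le> (\<Sum>b\<in>Basis. (spectral_norm A * norm (coord b Y))\<^sup>2)"
    unfolding norm_coord[of "mix A Y"] coord_mix
    by (intro sum_mono power_mono norm_matrix_vector_mult_le) simp
  also have "\<dots> = (spectral_norm A * norm Y)\<^sup>2"
    by (simp add: power_mult_distrib norm_coord[of Y] sum_distrib_left)
  finally show "(norm (mix A Y))\<^sup>2 \<le> (spectral_norm A * norm Y)\<^sup>2" .
qed (simp add: spectral_norm_nonneg)

section \<open>Dispersion\<close>

definition deviation :: "'a::real_vector^'n \<Rightarrow> 'a^'n" where
  "deviation Y = (\<chi> i. Y $ i - average Y)"

lemma dispersion_eq_norm_deviation:
  fixes Y :: "'a::real_normed_vector^'n"
  shows "dispersion Y = norm (deviation Y) / sqrt (real CARD('n))"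
  by (simp add: dispersion_def deviation_def norm_vec_def L2_set_def real_sqrt_divide)

lemma sum_eq_scaleR_average:
  "(\<Sum>i\<in>UNIV. (Y :: 'a::real_vector^'n) $ i) = real CARD('n) *\<^sub>R average Y"
  by (simp add: average_def)

lemma dispersion_triangle:
  fixes Y Z :: "'a::real_normed_vector^'n"
  shows "dispersion (Y + Z) \<le> dispersion Y + dispersion Z"
proof -
  have "deviation (Y + Z) = deviation Y + deviation Z"
    by (simp add: deviation_def average_def vec_eq_iff sum.distrib scaleR_add_right)
  then show ?thesis
    by (simp add: dispersion_eq_norm_deviation norm_triangle_ineq divide_right_mono
        flip: add_divide_distrib)
qed

text \<open>The average is the constant family closest to \<open>Y\<close>: the mean square deviation falls short of
  the mean square by the squared norm of the average.\<close>

lemma dispersion_le_norm: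
  fixes Y :: "'a::real_inner^'n"
  shows "dispersion Y \<le> norm Y / sqrt (real CARD('n))"
proof -
  have "(norm (deviation Y))\<^sup>2
      = (\<Sum>i\<in>UNIV. (norm (Y $ i))\<^sup>2 - 2 * (Y $ i \<bullet> average Y) + (norm (average Y))\<^sup>2)"
    by (simp add: norm_vec_sq deviation_def power2_norm_eq_inner inner_diff_left inner_diff_right
        inner_commute algebra_simps)
  also have "\<dots> = (norm Y)\<^sup>2 - 2 * ((\<Sum>i\<in>UNIV. Y $ i) \<bullet> average Y)
      + real CARD('n) * (norm (average Y))\<^sup>2"
    by (simp add: sum.distrib sum_subtractf norm_vec_sq inner_sum_left sum_distrib_left)
  also have "\<dots> = (norm Y)\<^sup>2 - real CARD('n) * (norm (average Y))\<^sup>2"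
    by (simp add: sum_eq_scaleR_average power2_norm_eq_inner)
  finally have "(norm (deviation Y))\<^sup>2 \<le> (norm Y)\<^sup>2" by simp
  then have "norm (deviation Y) \<le> norm Y" by (rule power2_le_imp_le) simp
  then show ?thesis
    by (simp add: dispersion_eq_norm_deviation divide_right_mono)
qed

lemma average_mix:
  fixes W :: "real^'n^'n"
  assumes "\<And>j. (\<Sum>i\<in>UNIV. W $ i $ j) = 1"
  shows "average (mix W Y) = average Y"
proof -
  have "(\<Sum>i\<in>UNIV. \<Sum>j\<in>UNIV. (W $ i $ j) *\<^sub>R Y $ j) = (\<Sum>j\<in>UNIV. Y $ j)"
    by (subst sum.swap) (simp add: assms flip: scaleR_sum_left)
  then show ?thesis by (simp add: average_def mix_def)
qed

text \<open>Row sums equal to one make \<open>W\<close> fix the constant family of averages, column sums equal to one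
  make it preserve the average, and the averaging matrix annihilates deviations.\<close>

lemma deviation_mix:
  fixes W :: "real^'n^'n"
  assumes rows: "\<And>i. (\<Sum>j\<in>UNIV. W $ i $ j) = 1" and cols: "\<And>j. (\<Sum>i\<in>UNIV. W $ i $ j) = 1"
  shows "deviation (mix W Y) = mix (W - (\<chi> i j. 1 / real CARD('n))) (deviation Y)"
proof -
  have sum0: "(\<Sum>j\<in>UNIV. deviation Y $ j) = 0"
    by (simp add: deviation_def sum_subtractf sum_eq_scaleR_average
        sum_constant_scaleR)
  have "mix (W - (\<chi> i j. 1 / real CARD('n))) (deviation Y) $ i = mix W Y $ i - average Y" for i
  proof -
    have "mix (W - (\<chi> i j. 1 / real CARD('n))) (deviation Y) $ i
        = (\<Sum>j\<in>UNIV. W $ i $ j *\<^sub>R deviation Y $ j)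
          - (1 / real CARD('n)) *\<^sub>R (\<Sum>j\<in>UNIV. deviation Y $ j)"
      by (simp add: mix_def scaleR_diff_left sum_subtractf scaleR_sum_right)
    also have "\<dots> = (\<Sum>j\<in>UNIV. W $ i $ j *\<^sub>R Y $ j) - (\<Sum>j\<in>UNIV. W $ i $ j) *\<^sub>R average Y"
      by (simp only: sum0 scaleR_zero_right)
        (simp add: deviation_def scaleR_diff_right sum_subtractf scaleR_sum_left)
    finally show ?thesis by (simp add: rows mix_def)
  qed
  then show ?thesis
    by (simp add: vec_eq_iff deviation_def[of "mix W Y"] average_mix[OF cols])
qed

lemma dispersion_mix:
  fixes W :: "real^'n^'n" and Y :: "'a::euclidean_space^'n"
  assumes "\<And>i. (\<Sum>j\<in>UNIV. W $ i $ j) = 1" and "\<And>j. (\<Sum>i\<in>UNIV. W $ i $ j) = 1"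
  shows "dispersion (mix W Y) \<le> contraction W * dispersion Y"
  using norm_mix_le[of "W - (\<chi> i j. 1 / real CARD('n))" "deviation Y"]
  by (simp add: dispersion_eq_norm_deviation deviation_mix[OF assms] contraction_def
      divide_right_mono)

lemma contraction_nonneg: "0 \<le> contraction W"
  by (simp add: contraction_def spectral_norm_nonneg)

lemma dispersion_mix_mat_pow:
  fixes W :: "real^'n^'n" and Y :: "'a::euclidean_space^'n"
  assumes "\<And>i. (\<Sum>j\<in>UNIV. W $ i $ j) = 1" and "\<And>j. (\<Sum>i\<in>UNIV. W $ i $ j) = 1"
  shows "dispersion (mix (mat_pow W m) Y) \<le> contraction W ^ m * dispersion Y"
proof (induction m)
  case 0
  then show ?case by (simp add: mix_mat_1)
next
  case (Suc m)
  have "dispersion (mix (mat_pow W (Suc m)) Y)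
      \<le> contraction W * dispersion (mix (mat_pow W m) Y)"
    by (simp add: mix_mult dispersion_mix assms)
  also have "\<dots> \<le> contraction W * (contraction W ^ m * dispersion Y)"
    by (rule mult_left_mono[OF Suc contraction_nonneg])
  finally show ?case by (simp add: mult.assoc)
qed

section \<open>Hessian increments\<close>

text \<open>Two distinct points exist, and a spectral norm is nonnegative.\<close>

lemma hessian_lipschitz_constant_nonneg:
  fixes f :: "real^'d \<Rightarrow> real"
  assumes "\<And>y z. spectral_norm (hessian f y - hessian f z) \<le> L * norm (y - z)"
  shows "0 \<le> L"
  using order_trans[OF spectral_norm_nonneg assms[of "axis undefined 1" 0]] by simp

lemma norm_hessians_diff_le:
  fixes f :: "'n::finite \<Rightarrow> real^'d \<Rightarrow> real" and X Y :: "real^'d^'n"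
  assumes lip: "\<And>i y z. spectral_norm (hessian (f i) y - hessian (f i) z) \<le> L * norm (y - z)"
  shows "norm (hessians f X - hessians f Y) \<le> sqrt (real CARD('d)) * L * norm (X - Y)"
proof (rule power2_le_imp_le)
  let ?c = "sqrt (real CARD('d)) * L"
  have entry: "norm (hessian (f i) (X $ i) - hessian (f i) (Y $ i)) \<le> ?c * norm (X $ i - Y $ i)"
    for i
  proof -
    have "norm (hessian (f i) (X $ i) - hessian (f i) (Y $ i))
        \<le> sqrt (real CARD('d)) * spectral_norm (hessian (f i) (X $ i) - hessian (f i) (Y $ i))"
      by (rule norm_le_spectral_norm)
    also have "\<dots> \<le> sqrt (real CARD('d)) * (L * norm (X $ i - Y $ i))"
      by (rule mult_left_mono[OF lip]) simp
    finally show ?thesis by (simp add: mult.assoc)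
  qed
  have "(norm (hessians f X - hessians f Y))\<^sup>2 \<le> (\<Sum>i\<in>UNIV. (?c * norm (X $ i - Y $ i))\<^sup>2)"
    unfolding norm_vec_sq[of "hessians f X - hessians f Y"]
    by (intro sum_mono power_mono) (simp_all add: hessians_def entry)
  also have "\<dots> = (?c * norm (X - Y))\<^sup>2"
    by (simp add: power_mult_distrib norm_vec_sq[of "X - Y"] flip: sum_distrib_left)
  finally show "(norm (hessians f X - hessians f Y))\<^sup>2 \<le> (?c * norm (X - Y))\<^sup>2" .
  show "0 \<le> ?c * norm (X - Y)"
    using hessian_lipschitz_constant_nonneg[OF lip] by simp
qed

section \<open>Dispersion of the tracked Hessians\<close>

theorem lemmaA8:
  fixes f :: "'n::finite \<Rightarrow> real^'d \<Rightarrow> real"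
    and W :: "real^'n^'n"
    and L\<^sub>1 L\<^sub>2 M D :: real
    and \<tau> t :: "nat \<Rightarrow> nat"
    and x g xt gt s :: "nat \<Rightarrow> real^'d^'n"
    and H Ht :: "nat \<Rightarrow> real^'d^'d^'n"
    and x_star :: "real^'d"
  assumes convex: "\<And>i. convex_on UNIV (f i)"
    and C2: "\<And>i. twice_cont_diff (f i)"
    and grad_lip: "\<And>i y z. norm (gradient (f i) y - gradient (f i) z) \<le> L\<^sub>1 * norm (y - z)"
    and hess_lip:
      "\<And>i y z. spectral_norm (hessian (f i) y - hessian (f i) z) \<le> L\<^sub>2 * norm (y - z)"
    and W: "mixing_matrix W"
    and coercive: "coercive (objective f)"
    and M: "M > 0" "M \<ge> L\<^sub>2"
    and rounds: "\<And>k. \<tau> k \<ge> 1" "\<And>k. t k \<ge> 1"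
    and alg: "disgrem W f M \<tau> t x g H xt gt Ht s"
    and minimizer: "is_arg_min (objective f) (\<lambda>_. True) x_star"
    and D: "D > 0"
    and bounded: "\<And>k. norm (average (x k) - x_star) \<le> D"
      "\<And>k i. norm (x k $ i - x_star) \<le> D"
      "\<And>k i. norm (xt k $ i - x_star) \<le> D"
  shows "\<forall>k. dispersion (Ht (k + 1))
            \<le> contraction W ^ \<tau> (k + 1) * contraction W ^ t k
              * (dispersion (Ht k)
                 + sqrt (real CARD('d)) * L\<^sub>2 / sqrt (real CARD('n)) * norm (x (k + 1) - x k))
          \<and> dispersion (Ht (k + 1))
            \<le> contraction W ^ \<tau> (k + 1) * contraction W ^ t k
              * (dispersion (Ht k) + 2 * sqrt (real CARD('d)) * L\<^sub>2 * D)"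
proof (intro allI)
  fix k
  have rows: "\<And>i. (\<Sum>j\<in>UNIV. W $ i $ j) = 1" and cols: "\<And>j. (\<Sum>i\<in>UNIV. W $ i $ j) = 1"
    using W by (auto simp: mixing_matrix_def)
  note mix_pow = dispersion_mix_mat_pow[OF rows cols]
  let ?\<rho> = "contraction W ^ \<tau> (k + 1) * contraction W ^ t k"
  let ?d = "sqrt (real CARD('d))" and ?n = "sqrt (real CARD('n))"
  let ?\<Delta> = "hessians f (x (Suc k)) - hessians f (x k)"
  have \<rho>: "0 \<le> ?\<rho>" by (simp add: contraction_nonneg)
  have c: "0 \<le> ?d * L\<^sub>2 / ?n"
    using hessian_lipschitz_constant_nonneg[OF hess_lip] by simp
  have Ht: "Ht (k + 1) = mix (mat_pow W (\<tau> (k + 1))) (mix (mat_pow W (t k)) (Ht k + ?\<Delta>))"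
    using alg by (simp add: disgrem_def add_diff_eq)
  have "dispersion (Ht (k + 1)) \<le> contraction W ^ \<tau> (k + 1)
      * dispersion (mix (mat_pow W (t k)) (Ht k + ?\<Delta>))"
    unfolding Ht by (rule mix_pow)
  also have "\<dots> \<le> contraction W ^ \<tau> (k + 1) * (contraction W ^ t k * dispersion (Ht k + ?\<Delta>))"
    by (intro mult_left_mono mix_pow) (simp add: contraction_nonneg)
  finally have contract: "dispersion (Ht (k + 1)) \<le> ?\<rho> * dispersion (Ht k + ?\<Delta>)"
    by (simp add: mult.assoc)
  have "dispersion ?\<Delta> \<le> norm ?\<Delta> / ?n" by (rule dispersion_le_norm)
  also have "\<dots> \<le> ?d * L\<^sub>2 * norm (x (Suc k) - x k) / ?n"
    by (intro divide_right_mono norm_hessians_diff_le hess_lip) simp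
  finally have "dispersion (Ht k + ?\<Delta>) \<le> dispersion (Ht k) + ?d * L\<^sub>2 / ?n * norm (x (k + 1) - x k)"
    using dispersion_triangle[of "Ht k" ?\<Delta>] by simp
  then have "?\<rho> * dispersion (Ht k + ?\<Delta>)
      \<le> ?\<rho> * (dispersion (Ht k) + ?d * L\<^sub>2 / ?n * norm (x (k + 1) - x k))"
    by (rule mult_left_mono[OF _ \<rho>])
  with contract have first:
    "dispersion (Ht (k + 1)) \<le> ?\<rho> * (dispersion (Ht k) + ?d * L\<^sub>2 / ?n * norm (x (k + 1) - x k))"
    by linarith
  have "norm ((x (k + 1) - x k) $ i) \<le> 2 * D" for i
    using norm_triangle_ineq4[of "x (k + 1) $ i - x_star" "x k $ i - x_star"]
      bounded(2)[of "k + 1" i] bounded(2)[of k i] by simp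
  then have "norm (x (k + 1) - x k) \<le> ?n * (2 * D)" by (rule norm_vec_le_uniform)
  then have "?d * L\<^sub>2 / ?n * norm (x (k + 1) - x k) \<le> ?d * L\<^sub>2 / ?n * (?n * (2 * D))"
    by (rule mult_left_mono[OF _ c])
  also have "\<dots> = 2 * ?d * L\<^sub>2 * D" by simp
  finally have "?\<rho> * (dispersion (Ht k) + ?d * L\<^sub>2 / ?n * norm (x (k + 1) - x k))
      \<le> ?\<rho> * (dispersion (Ht k) + 2 * ?d * L\<^sub>2 * D)"
    by (intro mult_left_mono \<rho> add_left_mono)
  with first show "dispersion (Ht (k + 1))
            \<le> ?\<rho> * (dispersion (Ht k) + ?d * L\<^sub>2 / ?n * norm (x (k + 1) - x k))
          \<and> dispersion (Ht (k + 1)) \<le> ?\<rho> * (dispersion (Ht k) + 2 * ?d * L\<^sub>2 * D)"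
    by linarith
qed

end
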